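(* Let $V=V^{(1)}\otimes\cdots\otimes V^{(d)}$ be a tensor product of finite dimensional complex Hilbert spaces, and let $T\in V$. If $T=\sum_{i=1}^r\sigma_iv_i$ is a diagonal singular value decomposition and $(v_1,\dots,v_r)$ is $t$-orthogonal for some real $t>2$, then the diagonal singular value decomposition of $T$ is unique up to the order of the summands; that is, if $T=\sum_{i=1}^s\lambda_iw_i$ is any diagonal singular value decomposition of $T$, then $s=r$ and there is a permutation $\phi$ of $\{1,\dots,r\}$ with $\lambda_i=\sigma_{\phi(i)}$ and $w_i=v_{\phi(i)}$ for all $i$.
   Context: $V$ carries the Hilbert space structure with $\langle v^{(1)}\otimes\cdots\otimes v^{(d)},w^{(1)}\otimes\cdots\otimes w^{(d)}\rangle=\prod_e\langle v^{(e)},w^{(e)}\rangle$. A pure tensor in $V$ is an element of the form $v^{(1)}\otimes\cdots\otimes v^{(d)}$ with $v^{(e)}\in V^{(e)}$. For an $r$-tuple $\mathbf{S}=(S_1,\dots,S_r)$ of tensors in $V$ and $\alpha>0$, $[\mathbf{S}]_\alpha$ is the maximum of $\big(\sum_{i=1}^r|\langle S_i,u\rangle|^\alpha\big)^{1/\alpha}$ over all pure tensors $u\in V$ of unit length. For real $t\geq 1$, an $r$-tuple $\mathbf{S}$ of tensors of unit length is called $t$-orthogonal if $[\mathbf{S}]_{2/t}=1$. A diagonal singular value decomposition of $T$ is a decomposition $T=\sum_{i=1}^r\sigma_iv_i$ where $\sigma_1\geq\sigma_2\geq\cdots\geq\sigma_r>0$ are real and $(v_1,\dots,v_r)$ is a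 $2$-orthogonal $r$-tuple of pure tensors of unit length. *)

theory Defs
  imports Complex_Main "HOL-Combinatorics.Permutations" "HOL-Library.Function_Algebras"
begin

text \<open>
  A Hilbert space is a finite dimensional subspace \<open>V\<close> of an ambient complex vector space,
  with an inner product of its own (linear in the first argument) that is only constrained on
  \<open>V\<close>. Completeness is automatic in finite dimension. A family of spaces over different
  underlying sets is covered as well: put its members inside their direct sum.
\<close>

locale fin_dim_hilbert = vector_space scale
  for scale :: "complex \<Rightarrow> 'a::ab_group_add \<Rightarrow> 'a" +
  fixes V :: "'a set"
    and ip :: "'a \<Rightarrow> 'a \<Rightarrow> complex"
  assumes subspace: "subspace V"
    and finite_dimensional: "\<exists>B. finite B \<and> span B = V"
    and ip_add: "\<lbrakk>x \<in> V; y \<in> V; z \<in> V\<rbrakk> \<Longrightarrow> ip (x + y) z = ip x z + ip y z"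
    and ip_scale: "\<lbrakk>x \<in> V; y \<in> V\<rbrakk> \<Longrightarrow> ip (scale c x) y = c * ip x y"
    and ip_commute: "\<lbrakk>x \<in> V; y \<in> V\<rbrakk> \<Longrightarrow> ip x y = cnj (ip y x)"
    and ip_pos: "\<lbrakk>x \<in> V; x \<noteq> 0\<rbrakk> \<Longrightarrow> Re (ip x x) > 0"

definition ip_norm :: "('a \<Rightarrow> 'a \<Rightarrow> complex) \<Rightarrow> 'a \<Rightarrow> real" where
  "ip_norm ip x = sqrt (Re (ip x x))"

text \<open>
  \<open>V\<close> is the tensor product of the Hilbert spaces \<open>H 1, \<dots>, H d\<close> with canonical multilinear
  map \<open>tens\<close>. The last two axioms say that the induced linear map from the algebraic tensor
  product to \<open>V\<close> is surjective and isometric, hence bijective. So this determines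
  \<open>(V, ip, tens)\<close> up to a unique isometry, and the universal property of the tensor product
  follows.
\<close>

locale hilbert_tensor_product = V: fin_dim_hilbert scale V ip
  for scale :: "complex \<Rightarrow> 'v::ab_group_add \<Rightarrow> 'v"
    and V :: "'v set"
    and ip :: "'v \<Rightarrow> 'v \<Rightarrow> complex" +
  fixes d :: nat
    and scaleH :: "complex \<Rightarrow> 'a::ab_group_add \<Rightarrow> 'a"
    and H :: "nat \<Rightarrow> 'a set"
    and ipH :: "nat \<Rightarrow> 'a \<Rightarrow> 'a \<Rightarrow> complex"
    and tens :: "(nat \<Rightarrow> 'a) \<Rightarrow> 'v"
  assumes factor: "e \<in> {1..d} \<Longrightarrow> fin_dim_hilbert scaleH (H e) (ipH e)"
    and tens_add: "\<lbrakk>x \<in> Pi\<^sub>E {1..d} H; e \<in> {1..d}; a \<in> H e; b \<in> H e\<rbrakk> \<Longrightarrow>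
          tens (x(e := a + b)) = tens (x(e := a)) + tens (x(e := b))"
    and tens_scale: "\<lbrakk>x \<in> Pi\<^sub>E {1..d} H; e \<in> {1..d}; a \<in> H e\<rbrakk> \<Longrightarrow>
          tens (x(e := scaleH c a)) = scale c (tens (x(e := a)))"
    and span_tens: "V.span (tens ` Pi\<^sub>E {1..d} H) = V"
    and ip_tens: "\<lbrakk>x \<in> Pi\<^sub>E {1..d} H; y \<in> Pi\<^sub>E {1..d} H\<rbrakk> \<Longrightarrow>
          ip (tens x) (tens y) = (\<Prod>e=1..d. ipH e (x e) (y e))"

definition pure_tensors :: "nat \<Rightarrow> (nat \<Rightarrow> 'a set) \<Rightarrow> ((nat \<Rightarrow> 'a) \<Rightarrow> 'v) \<Rightarrow> 'v set" where
  "pure_tensors d H tens = tens ` Pi\<^sub>E {1..d} H"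

text \<open>
  In what follows \<open>P\<close> is the set of pure tensors, and an \<open>r\<close>-tuple is a function of which only
  the values on \<open>{1..r}\<close> matter. The supremum below is a maximum whenever there is a unit pure
  tensor, since the unit pure tensors form a compact set.
\<close>

definition tensor_bracket ::
  "'v set \<Rightarrow> ('v \<Rightarrow> 'v \<Rightarrow> complex) \<Rightarrow> real \<Rightarrow> nat \<Rightarrow> (nat \<Rightarrow> 'v) \<Rightarrow> real" where
  "tensor_bracket P ip \<alpha> r S =
     (SUP u \<in> {u \<in> P. ip_norm ip u = 1}. (\<Sum>i=1..r. cmod (ip (S i) u) powr \<alpha>) powr (1 / \<alpha>))"

definition t_orthogonal ::
  "'v set \<Rightarrow> 'v set \<Rightarrow> ('v \<Rightarrow> 'v \<Rightarrow> complex) \<Rightarrow> real \<Rightarrow> nat \<Rightarrow> (nat \<Rightarrow> 'v) \<Rightarrow> bool" where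
  "t_orthogonal V P ip t r S \<longleftrightarrow>
     (\<forall>i\<in>{1..r}. S i \<in> V \<and> ip_norm ip (S i) = 1) \<and> tensor_bracket P ip (2 / t) r S = 1"

definition diagonal_svd ::
  "(complex \<Rightarrow> 'v \<Rightarrow> 'v) \<Rightarrow> 'v::ab_group_add set \<Rightarrow> 'v set \<Rightarrow> ('v \<Rightarrow> 'v \<Rightarrow> complex) \<Rightarrow>
    'v \<Rightarrow> nat \<Rightarrow> (nat \<Rightarrow> real) \<Rightarrow> (nat \<Rightarrow> 'v) \<Rightarrow> bool" where
  "diagonal_svd scale V P ip T r \<sigma> v \<longleftrightarrow>
     T = (\<Sum>i=1..r. scale (complex_of_real (\<sigma> i)) (v i)) \<and>
     (\<forall>i\<in>{1..r}. \<forall>j\<in>{1..r}. i \<le> j \<longrightarrow> \<sigma> j \<le> \<sigma> i) \<and>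
     (\<forall>i\<in>{1..r}. \<sigma> i > 0) \<and>
     (\<forall>i\<in>{1..r}. v i \<in> P) \<and>
     t_orthogonal V P ip 2 r v"


text \<open>
  The axioms are realised by coordinate spaces of arbitrary dimensions \<open>n 1, \<dots>, n d\<close>, with
  tensors as multidimensional arrays.
\<close>

definition coord_scale :: "complex \<Rightarrow> ('i \<Rightarrow> complex) \<Rightarrow> 'i \<Rightarrow> complex" where
  "coord_scale c x = (\<lambda>i. c * x i)"

definition coord_space :: "'i set \<Rightarrow> ('i \<Rightarrow> complex) set" where
  "coord_space I = {x. \<forall>i. i \<notin> I \<longrightarrow> x i = 0}"

definition coord_ip :: "'i set \<Rightarrow> ('i \<Rightarrow> complex) \<Rightarrow> ('i \<Rightarrow> complex) \<Rightarrow> complex" where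
  "coord_ip I x y = (\<Sum>i\<in>I. x i * cnj (y i))"

definition multi_indices :: "nat \<Rightarrow> (nat \<Rightarrow> nat) \<Rightarrow> (nat \<Rightarrow> nat) set" where
  "multi_indices d n = Pi\<^sub>E {1..d} (\<lambda>e. {..<n e})"

definition coord_tens ::
  "nat \<Rightarrow> (nat \<Rightarrow> nat) \<Rightarrow> (nat \<Rightarrow> nat \<Rightarrow> complex) \<Rightarrow> (nat \<Rightarrow> nat) \<Rightarrow> complex" where
  "coord_tens d n x = (\<lambda>m. if m \<in> multi_indices d n then \<Prod>e=1..d. x e (m e) else 0)"

definition coord_unit :: "'i \<Rightarrow> 'i \<Rightarrow> complex" where
  "coord_unit i = (\<lambda>j. if j = i then 1 else 0)"

lemma vector_space_coord: "vector_space coord_scale"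
  by unfold_locales (auto simp: coord_scale_def fun_eq_iff algebra_simps)

lemma subspace_coord: "module.subspace coord_scale (coord_space I)"
proof -
  interpret vector_space coord_scale by (rule vector_space_coord)
  show ?thesis
    by (auto simp: subspace_def coord_space_def coord_scale_def)
qed

lemma coord_expand:
  assumes "finite I" "x \<in> coord_space I"
  shows "x = (\<Sum>i\<in>I. coord_scale (x i) (coord_unit i))"
proof
  fix j
  have "(\<Sum>i\<in>I. coord_scale (x i) (coord_unit i)) j = (\<Sum>i\<in>I. if j = i then x i else 0)"
    using assms(1)
    by (induction I rule: finite_induct) (auto simp: coord_scale_def coord_unit_def)
  also have "\<dots> = x j"
    using assms by (auto simp: coord_space_def)
  finally show "x j = (\<Sum>i\<in>I. coord_scale (x i) (coord_unit i)) j" by simp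
qed

lemma span_coord_unit:
  assumes "finite I"
  shows "module.span coord_scale (coord_unit ` I) = coord_space I"
proof -
  interpret vector_space coord_scale by (rule vector_space_coord)
  have "x \<in> span (coord_unit ` I)" if "x \<in> coord_space I" for x
    by (subst coord_expand[OF assms that]) (intro span_sum span_scale span_base imageI)
  moreover have "coord_unit ` I \<subseteq> coord_space I"
    by (auto simp: coord_unit_def coord_space_def)
  ultimately show ?thesis
    using span_minimal[OF _ subspace_coord] by blast
qed

lemma fin_dim_hilbert_coord:
  assumes "finite I"
  shows "fin_dim_hilbert coord_scale (coord_space I) (coord_ip I)"
proof -
  interpret vector_space coord_scale by (rule vector_space_coord)
  show ?thesis
  proof
    show "\<exists>B. finite B \<and> span B = coord_space I"
      using span_coord_unit[OF assms] assms by blast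
  next
    fix x :: "'a \<Rightarrow> complex" assume x: "x \<in> coord_space I" "x \<noteq> 0"
    then obtain i where i: "i \<in> I" "x i \<noteq> 0"
      by (auto simp: coord_space_def fun_eq_iff)
    have "(\<Sum>i\<in>I. (cmod (x i))\<^sup>2) > 0"
      by (rule sum_pos2[OF assms i(1)]) (use i in auto)
    then show "Re (coord_ip I x x) > 0"
      by (simp add: coord_ip_def complex_mult_cnj cmod_power2)
  qed (auto simp: subspace_coord coord_ip_def coord_scale_def algebra_simps sum.distrib
        sum_distrib_left)
qed

lemma hilbert_tensor_product_coord:
  "hilbert_tensor_product coord_scale (coord_space (multi_indices d n))
     (coord_ip (multi_indices d n)) d coord_scale (\<lambda>e. coord_space {..<n e})
     (\<lambda>e. coord_ip {..<n e}) (coord_tens d n)"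
proof -
  let ?M = "multi_indices d n" and ?H = "\<lambda>e. coord_space {..<n e}"
  have fin: "finite ?M"
    unfolding multi_indices_def by (intro finite_PiE) auto
  interpret fin_dim_hilbert coord_scale "coord_space ?M" "coord_ip ?M"
    by (rule fin_dim_hilbert_coord[OF fin])
  have upd: "(\<Prod>e'=1..d. (x(e := a)) e' (m e')) = a (m e) * (\<Prod>e'\<in>{1..d}-{e}. x e' (m e'))"
    if "e \<in> {1..d}" for x :: "nat \<Rightarrow> nat \<Rightarrow> complex" and e a m
    using that by (subst prod.remove[of _ e]) auto
  show ?thesis
  proof (rule hilbert_tensor_product.intro[OF fin_dim_hilbert_axioms],
      rule hilbert_tensor_product_axioms.intro)
    fix e
    show "fin_dim_hilbert coord_scale (?H e) (coord_ip {..<n e})"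
      by (rule fin_dim_hilbert_coord) simp
  next
    fix x :: "nat \<Rightarrow> nat \<Rightarrow> complex" and e a b
    assume e: "e \<in> {1..d}"
    show "coord_tens d n (x(e := a + b)) =
        coord_tens d n (x(e := a)) + coord_tens d n (x(e := b))"
      by (auto simp: coord_tens_def upd[OF e] fun_eq_iff ring_distribs simp del: fun_upd_apply One_nat_def)
  next
    fix x :: "nat \<Rightarrow> nat \<Rightarrow> complex" and e a c
    assume e: "e \<in> {1..d}"
    show "coord_tens d n (x(e := coord_scale c a)) =
        coord_scale c (coord_tens d n (x(e := a)))"
      by (auto simp: coord_tens_def upd[OF e] fun_eq_iff coord_scale_def simp del: fun_upd_apply One_nat_def)
  next
    have unit: "coord_unit m \<in> coord_tens d n ` Pi\<^sub>E {1..d} ?H" if m: "m \<in> ?M" for m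
    proof
      let ?x = "\<lambda>e\<in>{1..d}. coord_unit (m e)"
      show "?x \<in> Pi\<^sub>E {1..d} ?H"
        using m by (auto simp: multi_indices_def coord_space_def coord_unit_def PiE_iff)
      have val: "(\<Prod>e=1..d. ?x e (k e)) = (if k = m then 1 else 0)" if k: "k \<in> ?M" for k
      proof (cases "k = m")
        case True
        then show ?thesis by (auto simp: coord_unit_def)
      next
        case False
        then obtain e where "e \<in> {1..d}" "k e \<noteq> m e"
          using PiE_ext[of k "{1..d}" _ m] k m unfolding multi_indices_def by blast
        then have "(\<Prod>e=1..d. ?x e (k e)) = 0"
          by (intro prod_zero bexI[of _ e]) (auto simp: coord_unit_def)
        then show ?thesis using False by simp
      qed
      show "coord_unit m = coord_tens d n ?x"
      proof
        fix k
        show "coord_unit m k = coord_tens d n ?x k"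
        proof (cases "k \<in> ?M")
          case True
          then show ?thesis
            by (simp only: coord_tens_def val if_True) (simp add: coord_unit_def)
        next
          case False
          then show ?thesis using m by (auto simp: coord_tens_def coord_unit_def)
        qed
      qed
    qed
    show "span (coord_tens d n ` Pi\<^sub>E {1..d} ?H) = coord_space ?M"
    proof
      show "span (coord_tens d n ` Pi\<^sub>E {1..d} ?H) \<subseteq> coord_space ?M"
        by (rule span_minimal[OF _ subspace_coord]) (auto simp: coord_tens_def coord_space_def)
      have "span (coord_unit ` ?M) \<subseteq> span (coord_tens d n ` Pi\<^sub>E {1..d} ?H)"
        using unit by (intro span_mono) blast
      then show "coord_space ?M \<subseteq> span (coord_tens d n ` Pi\<^sub>E {1..d} ?H)"
        by (simp add: span_coord_unit[OF fin])
    qed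
  next
    fix x y :: "nat \<Rightarrow> nat \<Rightarrow> complex"
    have "coord_ip ?M (coord_tens d n x) (coord_tens d n y) =
        (\<Sum>m\<in>?M. \<Prod>e=1..d. x e (m e) * cnj (y e (m e)))"
      unfolding coord_ip_def
      by (rule sum.cong) (auto simp: coord_tens_def prod.distrib)
    also have "\<dots> = (\<Prod>e=1..d. coord_ip {..<n e} (x e) (y e))"
      unfolding coord_ip_def multi_indices_def
      by (rule prod_sum_PiE[symmetric]) auto
    finally show "coord_ip ?M (coord_tens d n x) (coord_tens d n y) =
        (\<Prod>e=1..d. coord_ip {..<n e} (x e) (y e))" .
  qed
qed

end

theory Submission
  imports Defs
begin

text \<open>
  Testing \<open>2\<close>-orthogonality against the unit pure tensors \<open>v\<^sub>j\<close> shows that \<open>(v\<^sub>i)\<close> and \<open>(w\<^sub>j)\<close> are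
  orthonormal. If \<open>\<mu>\<^sub>1\<close> is the largest coefficient of \<open>w\<close>, then
  \<open>\<sigma>\<^sub>i = \<langle>T, v\<^sub>i\<rangle> \<le> \<mu>\<^sub>1 \<Sum>\<^sub>j |\<langle>w\<^sub>j, v\<^sub>i\<rangle>| \<le> \<mu>\<^sub>1\<close>, and with \<open>x\<^sub>i = \<langle>v\<^sub>i, w\<^sub>1\<rangle>\<close> and \<open>\<alpha> = 2 / t < 1\<close>
  \<open>\<mu>\<^sub>1 = \<langle>T, w\<^sub>1\<rangle> = \<Sum>\<^sub>i \<sigma>\<^sub>i x\<^sub>i \<le> \<mu>\<^sub>1 \<Sum>\<^sub>i |x\<^sub>i| \<le> \<mu>\<^sub>1 \<Sum>\<^sub>i |x\<^sub>i|\<^sup>\<alpha> \<le> \<mu>\<^sub>1\<close>.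
  All these are equalities, so each \<open>|x\<^sub>i|\<close> is \<open>0\<close> or \<open>1\<close>; some \<open>x\<^sub>i\<close> is nonzero, and for it
  \<open>x\<^sub>i = 1\<close>, \<open>\<sigma>\<^sub>i = \<mu>\<^sub>1\<close> and \<open>v\<^sub>i = w\<^sub>1\<close>. Cancel this term on both sides and induct.
\<close>

section \<open>Inner product identities and unit vectors\<close>

context fin_dim_hilbert
begin

lemma ip_diff:
  assumes "x \<in> V" "y \<in> V" "z \<in> V"
  shows "ip (x - y) z = ip x z - ip y z"
  using ip_add[of "x - y" y z] assms subspace_diff[OF subspace] by simp

lemma ip_sum_scale:
  assumes "finite I" "\<And>i. i \<in> I \<Longrightarrow> x i \<in> V" "z \<in> V"
  shows "ip (\<Sum>i\<in>I. scale (c i) (x i)) z = (\<Sum>i\<in>I. c i * ip (x i) z)"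
  using assms(1,2)
proof (induction I rule: finite_induct)
  case empty
  show ?case using ip_diff[of 0 0 z] assms(3) subspace_0[OF subspace] by simp
next
  case (insert i I)
  then have "(\<Sum>i\<in>I. scale (c i) (x i)) \<in> V"
    by (intro subspace_sum[OF subspace] subspace_scale[OF subspace]) auto
  with insert show ?case
    using assms(3) by (simp add: ip_add ip_scale subspace_scale[OF subspace])
qed

lemma ip_scale_right:
  assumes "x \<in> V" "y \<in> V"
  shows "ip x (scale c y) = cnj c * ip x y"
  using assms ip_commute[of x "scale c y"] ip_commute[of x y] subspace_scale[OF subspace]
  by (simp add: ip_scale)

lemma ip_self_diff:
  assumes "x \<in> V" "y \<in> V"
  shows "ip (x - y) (x - y) = ip x x - ip x y - cnj (ip x y) + ip y y"
proof -
  have xy: "x - y \<in> V" using assms subspace_diff[OF subspace] by blast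
  have "ip z (x - y) = ip z x - ip z y" if "z \<in> V" for z
    using that assms xy ip_commute[of z "x - y"] ip_commute[of z x] ip_commute[of z y]
    by (simp add: ip_diff)
  then show ?thesis
    using assms xy ip_commute[of y x] by (simp add: ip_diff)
qed

lemma ip_self_nonneg: "x \<in> V \<Longrightarrow> Re (ip x x) \<ge> 0"
  using ip_pos[of x] ip_diff[of 0 0 0] subspace_0[OF subspace] by (cases "x = 0") auto

lemma ip_self_unit:
  assumes "x \<in> V" "ip_norm ip x = 1"
  shows "ip x x = 1"
proof (rule complex_eqI)
  show "Re (ip x x) = Re 1" using assms(2) by (simp add: ip_norm_def)
  have "Im (ip x x) = - Im (ip x x)"
    using ip_commute[OF assms(1) assms(1)] by (metis cnj.simps(2))
  then show "Im (ip x x) = Im 1" by simp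
qed

text \<open>Cauchy-Schwarz for unit vectors: rotating \<open>y\<close> by the phase \<open>c\<close>
  of \<open>ip x y\<close> gives \<open>ip x (scale c y) = |ip x y|\<close>, so the squared length
  of \<open>x - scale c y\<close> is \<open>2 - 2 * |ip x y|\<close>, which is nonnegative.\<close>

lemma cmod_ip_unit_le:
  assumes "x \<in> V" "y \<in> V" "ip_norm ip x = 1" "ip_norm ip y = 1"
  shows "cmod (ip x y) \<le> 1"
proof (cases "ip x y = 0")
  case False
  define c where "c = sgn (ip x y)"
  have cc: "c * cnj c = 1"
    using False by (simp add: c_def complex_norm_square[symmetric] norm_sgn)
  have c1: "cnj c * ip x y = of_real (cmod (ip x y))"
    unfolding c_def sgn_eq using False
    by (simp add: field_simps complex_norm_square[symmetric] power2_eq_square)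
  have cy: "scale c y \<in> V" using assms subspace_scale[OF subspace] by blast
  have "ip (scale c y) (scale c y) = 1"
    using assms cy cc by (simp add: ip_scale ip_scale_right ip_self_unit mult.commute)
  then have "ip (x - scale c y) (x - scale c y) = 2 - 2 * of_real (cmod (ip x y))"
    using assms c1 cy by (simp add: ip_self_diff ip_scale_right ip_self_unit)
  then show ?thesis
    using ip_self_nonneg[of "x - scale c y"] assms cy subspace_diff[OF subspace] by simp
qed simp

lemma unit_eqI:
  assumes "x \<in> V" "y \<in> V" "ip_norm ip x = 1" "ip_norm ip y = 1" "ip x y = 1"
  shows "x = y"
proof (rule ccontr)
  assume "x \<noteq> y"
  then have "Re (ip (x - y) (x - y)) > 0"
    using ip_pos[of "x - y"] assms subspace_diff[OF subspace] by auto
  then show False using assms by (simp add: ip_self_diff ip_self_unit)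
qed

section \<open>From brackets to sum bounds and orthonormality\<close>

text \<open>Replaces the supremum by a bound at each unit pure tensor, the only form in which
  orthogonality enters the later argument.\<close>

lemma t_orthogonal_sum_le:
  assumes orth: "t_orthogonal V P ip t r S" and t: "t > 0"
    and u: "u \<in> P" "P \<subseteq> V" "ip_norm ip u = 1"
  shows "(\<Sum>i=1..r. cmod (ip (S i) u) powr (2 / t)) \<le> 1"
proof -
  let ?f = "\<lambda>u. \<Sum>i=1..r. cmod (ip (S i) u) powr (2 / t)"
  let ?g = "\<lambda>u. ?f u powr (1 / (2 / t))"
  \<comment> \<open>A real \<open>SUP\<close> bounds its members only when the set is bounded above;
    each of the \<open>r\<close> summands is at most 1 by Cauchy-Schwarz.\<close>
  have "?g x \<le> real r powr (1 / (2 / t))" if "x \<in> P" "ip_norm ip x = 1" for x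
  proof -
    have "?f x \<le> (\<Sum>i=1..r. 1)"
    proof (rule sum_mono)
      fix i assume "i \<in> {1..r}"
      then have "cmod (ip (S i) x) \<le> 1"
        using orth that u(2) by (intro cmod_ip_unit_le) (auto simp: t_orthogonal_def)
      then show "cmod (ip (S i) x) powr (2 / t) \<le> 1"
        using t by (intro powr_le1) auto
    qed
    then show ?thesis
      using t by (intro powr_mono2) (auto intro: sum_nonneg)
  qed
  then have bdd: "bdd_above (?g ` {u \<in> P. ip_norm ip u = 1})"
    by (intro bdd_aboveI2[where M = "real r powr (1 / (2 / t))"]) blast
  have "?g u \<le> tensor_bracket P ip (2 / t) r S"
    unfolding tensor_bracket_def by (rule cSUP_upper[OF _ bdd]) (use u in auto)
  also have "\<dots> = 1" using orth by (simp add: t_orthogonal_def)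
  finally have "?g u \<le> 1" .
  \<comment> \<open>The outer exponent is positive, so a sum above 1 would keep its power above
    1.\<close>
  then show ?thesis
    using gr_one_powr[of "?f u" "1 / (2 / t)"] t by fastforce
qed

text \<open>The summand \<open>k = i\<close> already equals 1, which leaves nothing for the
  others.\<close>

lemma orthonormal_of_sum_le:
  assumes "finite I" "i \<in> I" "j \<in> I" "v i \<in> V" "ip_norm ip (v i) = 1"
    and "(\<Sum>k\<in>I. cmod (ip (v k) (v i))) \<le> 1"
  shows "ip (v j) (v i) = (if j = i then 1 else 0)"
proof (cases "j = i")
  case False
  have "(\<Sum>k\<in>I. cmod (ip (v k) (v i))) = 1 + (\<Sum>k\<in>I - {i}. cmod (ip (v k) (v i)))"
    using assms by (simp add: sum.remove ip_self_unit)
  moreover have "cmod (ip (v j) (v i)) \<le> (\<Sum>k\<in>I - {i}. cmod (ip (v k) (v i)))"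
    using assms False by (intro member_le_sum) auto
  ultimately have "cmod (ip (v j) (v i)) \<le> 0"
    using assms(6) by linarith
  then show ?thesis using False by simp
qed (use assms in \<open>simp add: ip_self_unit\<close>)

lemma ip_orthogonal_combination:
  assumes "finite I" "i \<in> I"
    and "\<And>k. k \<in> I \<Longrightarrow> v k \<in> V" "ip_norm ip (v i) = 1"
    and "(\<Sum>k\<in>I. cmod (ip (v k) (v i))) \<le> 1"
  shows "ip (\<Sum>k\<in>I. scale (c k) (v k)) (v i) = c i"
proof -
  have "ip (\<Sum>k\<in>I. scale (c k) (v k)) (v i) = (\<Sum>k\<in>I. c k * ip (v k) (v i))"
    using assms by (intro ip_sum_scale) auto
  also have "\<dots> = (\<Sum>k\<in>I. if k = i then c k else 0)"
    using assms orthonormal_of_sum_le[of I i _ v] by (intro sum.cong) auto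
  finally show ?thesis using assms by simp
qed

section \<open>Matching the terms of two decompositions\<close>

text \<open>The single matching step. The two families enter asymmetrically: the exponent below 1 on
  the \<open>v\<close> side gives rigidity, while exponent 1 suffices for \<open>w\<close>.\<close>

lemma top_term_occurs:
  fixes \<sigma> :: "'i \<Rightarrow> real" and \<mu> :: "'j \<Rightarrow> real"
  assumes fin: "finite I" "finite J" and PV: "P \<subseteq> V"
    and v: "\<And>i. i \<in> I \<Longrightarrow> v i \<in> P \<and> ip_norm ip (v i) = 1"
    and w: "\<And>j. j \<in> J \<Longrightarrow> w j \<in> P \<and> ip_norm ip (w j) = 1"
    and \<alpha>: "0 < \<alpha>" "\<alpha> < 1"
    and vsum: "\<And>u. u \<in> P \<Longrightarrow> ip_norm ip u = 1 \<Longrightarrow> (\<Sum>i\<in>I. cmod (ip (v i) u) powr \<alpha>) \<le> 1"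
    and wsum: "\<And>u. u \<in> P \<Longrightarrow> ip_norm ip u = 1 \<Longrightarrow> (\<Sum>j\<in>J. cmod (ip (w j) u)) \<le> 1"
    and eq: "(\<Sum>i\<in>I. scale (of_real (\<sigma> i)) (v i)) = (\<Sum>j\<in>J. scale (of_real (\<mu> j)) (w j))"
    and \<sigma>: "\<And>i. i \<in> I \<Longrightarrow> \<sigma> i > 0"
    and j: "j \<in> J" "\<mu> j > 0" "\<And>k. k \<in> J \<Longrightarrow> 0 \<le> \<mu> k \<and> \<mu> k \<le> \<mu> j"
  shows "\<exists>i\<in>I. \<sigma> i = \<mu> j \<and> v i = w j"
proof -
  define x where "x i = ip (v i) (w j)" for i
  have vV: "v i \<in> V" if "i \<in> I" for i using v PV that by blast
  have wV: "w k \<in> V" if "k \<in> J" for k using w PV that by blast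
  \<comment> \<open>On [0, 1] a smaller exponent gives a larger power, so the bound for
    \<open>\<alpha>\<close> implies the one for exponent 1.\<close>
  have le_powr: "cmod (ip (v i) u) \<le> cmod (ip (v i) u) powr \<alpha>"
    if "i \<in> I" "u \<in> P" "ip_norm ip u = 1" for i u
    using powr_mono'[of \<alpha> 1 "cmod (ip (v i) u)"] cmod_ip_unit_le[of "v i" u] vV v that \<alpha> PV
    by auto
  have vsum1: "(\<Sum>i\<in>I. cmod (ip (v i) u)) \<le> 1" if "u \<in> P" "ip_norm ip u = 1" for u
    using sum_mono[of I "\<lambda>i. cmod (ip (v i) u)"] le_powr vsum[OF that] that
    by (meson order_trans)
  have \<sigma>_le: "\<sigma> i \<le> \<mu> j" if i: "i \<in> I" for i
  proof -
    have "of_real (\<sigma> i) = ip (\<Sum>k\<in>I. scale (of_real (\<sigma> k)) (v k)) (v i)"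
      using fin i v vV vsum1 by (intro ip_orthogonal_combination[symmetric]) auto
    also have "\<dots> = (\<Sum>k\<in>J. of_real (\<mu> k) * ip (w k) (v i))"
      unfolding eq using fin i vV wV by (intro ip_sum_scale) auto
    finally have "\<sigma> i = cmod (\<Sum>k\<in>J. of_real (\<mu> k) * ip (w k) (v i))"
      using \<sigma>[OF i] by (metis abs_of_pos norm_of_real)
    also have "\<dots> \<le> (\<Sum>k\<in>J. \<mu> j * cmod (ip (w k) (v i)))"
      using j by (intro sum_norm_le) (auto simp: norm_mult intro!: mult_right_mono)
    also have "\<dots> \<le> \<mu> j"
      using wsum[of "v i"] v[OF i] j(2)
      by (simp add: sum_distrib_left[symmetric] mult_left_le)
    finally show ?thesis .
  qed
  have "of_real (\<mu> j) = ip (\<Sum>k\<in>J. scale (of_real (\<mu> k)) (w k)) (w j)"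
    using fin j w wV wsum by (intro ip_orthogonal_combination[symmetric]) auto
  also have "\<dots> = (\<Sum>i\<in>I. of_real (\<sigma> i) * x i)"
    unfolding eq[symmetric] x_def using fin j vV wV by (intro ip_sum_scale) auto
  finally have "Re (of_real (\<mu> j)) = Re (\<Sum>i\<in>I. of_real (\<sigma> i) * x i)"
    by (rule arg_cong)
  then have \<mu>_eq: "\<mu> j = (\<Sum>i\<in>I. \<sigma> i * Re (x i))" by simp
  have x1: "cmod (x i) \<le> cmod (x i) powr \<alpha>" "\<sigma> i * Re (x i) \<le> \<mu> j * cmod (x i)"
    if i: "i \<in> I" for i
  proof -
    show "cmod (x i) \<le> cmod (x i) powr \<alpha>"
      unfolding x_def using le_powr i w j by blast
    have "\<sigma> i * Re (x i) \<le> \<sigma> i * cmod (x i)"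
      using \<sigma>[OF i] complex_Re_le_cmod[of "x i"] by (intro mult_left_mono) auto
    also have "\<dots> \<le> \<mu> j * cmod (x i)"
      using \<sigma>_le[OF i] by (intro mult_right_mono) auto
    finally show "\<sigma> i * Re (x i) \<le> \<mu> j * cmod (x i)" .
  qed
  have termwise: "\<sigma> i * Re (x i) \<le> \<mu> j * cmod (x i) powr \<alpha>" if "i \<in> I" for i
    using x1[OF that] mult_left_mono[of "cmod (x i)" "cmod (x i) powr \<alpha>" "\<mu> j"] j(2) by linarith
  have "(\<Sum>i\<in>I. cmod (x i) powr \<alpha>) \<le> 1"
    unfolding x_def using vsum w j by blast
  \<comment> \<open>The left sum is at most \<open>\<mu> j\<close>, which is the right sum; together
    with \<open>termwise\<close> this forces equality in every term.\<close>
  then have "(\<Sum>i\<in>I. \<mu> j * cmod (x i) powr \<alpha>) \<le> (\<Sum>i\<in>I. \<sigma> i * Re (x i))"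
    using j(2) by (simp add: \<mu>_eq[symmetric] sum_distrib_left[symmetric] mult_left_le)
  moreover have "(\<Sum>i\<in>I. \<sigma> i * Re (x i)) \<le> (\<Sum>i\<in>I. \<mu> j * cmod (x i) powr \<alpha>)"
    using termwise by (intro sum_mono)
  ultimately have "(\<Sum>i\<in>I. \<sigma> i * Re (x i)) = (\<Sum>i\<in>I. \<mu> j * cmod (x i) powr \<alpha>)"
    by linarith
  then have tight: "\<sigma> i * Re (x i) = \<mu> j * cmod (x i) powr \<alpha>" if "i \<in> I" for i
    using sum_mono_inv[of "\<lambda>i. \<sigma> i * Re (x i)" I "\<lambda>i. \<mu> j * cmod (x i) powr \<alpha>" i] termwise that fin(1)
    by blast
  obtain i where i: "i \<in> I" "x i \<noteq> 0"
    using \<mu>_eq j(2) by (metis (no_types, lifting) less_irrefl mult_zero_right sum.neutral zero_complex.simps(1))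
  \<comment> \<open>By \<open>tight\<close> the right side is \<open>\<sigma> i * Re (x i)\<close>,
    which \<open>x1\<close> bounds by the left side.\<close>
  have "\<mu> j * cmod (x i) = \<mu> j * cmod (x i) powr \<alpha>"
    using x1[OF i(1)] tight[OF i(1)] j(2) by (intro antisym mult_left_mono) auto
  then have "cmod (x i) powr 1 = cmod (x i) powr \<alpha>" using j(2) by simp
  \<comment> \<open>A positive base other than 1 would give \<open>\<alpha> = 1\<close>; the strict
    inequality \<open>\<alpha> < 1\<close> excludes this.\<close>
  then have cm: "cmod (x i) = 1"
    using i(2) \<alpha> powr_inj[of "cmod (x i)" 1 \<alpha>] by auto
  then have s: "\<sigma> i * Re (x i) = \<mu> j" using tight[OF i(1)] by simp
  have Re_le: "Re (x i) \<le> 1" using complex_Re_le_cmod[of "x i"] cm by simp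
  \<comment> \<open>With \<open>\<sigma> i \<le> \<mu> j\<close> and
    \<open>Re (x i) \<le> 1\<close>, the product can reach \<open>\<mu> j\<close> only if both
    bounds are attained.\<close>
  have "\<sigma> i * Re (x i) \<le> \<sigma> i" using \<sigma>[OF i(1)] Re_le by (simp add: mult_left_le)
  then have sm: "\<sigma> i = \<mu> j" using s \<sigma>_le[OF i(1)] by linarith
  then have re: "Re (x i) = 1" using s j(2) by simp
  then have "x i = 1" using cm cmod_power2[of "x i"] by (simp add: complex_eq_iff)
  then have "v i = w j"
    using unit_eqI[of "v i" "w j"] vV v w wV i j by (simp add: x_def)
  then show ?thesis using sm i by blast
qed

text \<open>Arbitrary finite index sets let a matched pair be removed without renumbering. The sum
  bounds pass to subfamilies, whereas a bracket equal to 1 would drop to 0 once the last term is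
  gone.\<close>

lemma combination_unique:
  fixes \<sigma> :: "'i \<Rightarrow> real" and \<mu> :: "'j \<Rightarrow> real"
  assumes "finite I" "finite J" and "P \<subseteq> V"
    and "\<And>i. i \<in> I \<Longrightarrow> v i \<in> P \<and> ip_norm ip (v i) = 1"
    and "\<And>j. j \<in> J \<Longrightarrow> w j \<in> P \<and> ip_norm ip (w j) = 1"
    and "0 < \<alpha>" "\<alpha> < 1"
    and "\<And>u. u \<in> P \<Longrightarrow> ip_norm ip u = 1 \<Longrightarrow> (\<Sum>i\<in>I. cmod (ip (v i) u) powr \<alpha>) \<le> 1"
    and "\<And>u. u \<in> P \<Longrightarrow> ip_norm ip u = 1 \<Longrightarrow> (\<Sum>j\<in>J. cmod (ip (w j) u)) \<le> 1"
    and "(\<Sum>i\<in>I. scale (of_real (\<sigma> i)) (v i)) = (\<Sum>j\<in>J. scale (of_real (\<mu> j)) (w j))"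
    and "\<And>i. i \<in> I \<Longrightarrow> \<sigma> i > 0" and "\<And>j. j \<in> J \<Longrightarrow> \<mu> j > 0"
  shows "\<exists>\<phi>. bij_betw \<phi> J I \<and> (\<forall>j\<in>J. \<mu> j = \<sigma> (\<phi> j) \<and> w j = v (\<phi> j))"
  using assms(2,1,4,5,8-)
proof (induction "card J" arbitrary: I J)
  case 0
  then have J: "J = {}" by simp
  \<comment> \<open>The combination over \<open>J\<close> is now 0, while pairing the one over
    \<open>I\<close> with \<open>v i\<close> would return \<open>\<sigma> i > 0\<close>.\<close>
  have "I = {}"
  proof (rule ccontr)
    assume "I \<noteq> {}"
    then obtain i where i: "i \<in> I" by blast
    have "cmod (ip (v k) (v i)) \<le> cmod (ip (v k) (v i)) powr \<alpha>" if "k \<in> I" for k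
      using powr_mono'[of \<alpha> 1 "cmod (ip (v k) (v i))"] cmod_ip_unit_le[of "v k" "v i"]
        "0.prems"(3) that i assms(3,6,7) by auto
    then have "(\<Sum>k\<in>I. cmod (ip (v k) (v i))) \<le> 1"
      using sum_mono[of I "\<lambda>k. cmod (ip (v k) (v i))"] "0.prems"(5)[of "v i"] "0.prems"(3)[OF i]
      by (meson order_trans)
    then have "ip (\<Sum>k\<in>I. scale (of_real (\<sigma> k)) (v k)) (v i) = of_real (\<sigma> i)"
      using "0.prems"(2,3) i assms(3) by (intro ip_orthogonal_combination) auto
    moreover have "ip 0 (v i) = 0"
      using ip_sum_scale[of "{}" v "v i"] "0.prems"(3)[OF i] assms(3) by auto
    ultimately show False using "0.prems"(7) "0.prems"(8)[OF i] J by simp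
  qed
  then show ?case using J by (auto simp: bij_betw_def)
next
  case (Suc n)
  note fin = Suc.prems(1,2)
  have "J \<noteq> {}" using Suc.hyps(2) by auto
  then have "Max (\<mu> ` J) \<in> \<mu> ` J" using fin by (intro Max_in) auto
  then obtain j where j: "j \<in> J" "\<mu> j = Max (\<mu> ` J)" by force
  have jmax: "0 \<le> \<mu> k \<and> \<mu> k \<le> \<mu> j" if "k \<in> J" for k
    using that j fin Suc.prems(9)[OF that] by simp
  have "\<exists>i\<in>I. \<sigma> i = \<mu> j \<and> v i = w j"
    by (rule top_term_occurs[where P = P and \<alpha> = \<alpha> and J = J])
      (use Suc.prems assms(3,6,7) j(1) jmax in auto)
  then obtain i where i: "i \<in> I" "\<sigma> i = \<mu> j" "v i = w j" by blast
  have "\<exists>\<phi>. bij_betw \<phi> (J - {j}) (I - {i}) \<and>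
      (\<forall>k\<in>J - {j}. \<mu> k = \<sigma> (\<phi> k) \<and> w k = v (\<phi> k))"
  proof (rule Suc.hyps(1))
    show "n = card (J - {j})" using Suc.hyps(2) j fin by simp
    \<comment> \<open>The removed terms have equal coefficients and equal vectors, so they
      cancel.\<close>
    show "(\<Sum>i\<in>I - {i}. scale (of_real (\<sigma> i)) (v i)) = (\<Sum>j\<in>J - {j}. scale (of_real (\<mu> j)) (w j))"
      using Suc.prems(7) fin i j
      by (simp add: sum.remove[of I i] sum.remove[of J j])
    fix u assume u: "u \<in> P" "ip_norm ip u = 1"
    have "(\<Sum>k\<in>I - {i}. cmod (ip (v k) u) powr \<alpha>) \<le> (\<Sum>k\<in>I. cmod (ip (v k) u) powr \<alpha>)"
      using fin by (intro sum_mono2) auto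
    then show "(\<Sum>k\<in>I - {i}. cmod (ip (v k) u) powr \<alpha>) \<le> 1"
      using Suc.prems(5)[OF u] by linarith
    have "(\<Sum>k\<in>J - {j}. cmod (ip (w k) u)) \<le> (\<Sum>k\<in>J. cmod (ip (w k) u))"
      using fin by (intro sum_mono2) auto
    then show "(\<Sum>k\<in>J - {j}. cmod (ip (w k) u)) \<le> 1"
      using Suc.prems(6)[OF u] by linarith
  qed (use Suc.prems in auto)
  then obtain \<phi> where \<phi>: "bij_betw \<phi> (J - {j}) (I - {i})"
      "\<And>k. k \<in> J - {j} \<Longrightarrow> \<mu> k = \<sigma> (\<phi> k) \<and> w k = v (\<phi> k)" by blast
  have "bij_betw (\<phi>(j := i)) (J - {j}) (I - {i})"
    using \<phi>(1) by (subst bij_betw_cong[where g = \<phi>]) auto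
  then have "bij_betw (\<phi>(j := i)) (insert j (J - {j})) (insert i (I - {i}))"
    using notIn_Un_bij_betw[of j "J - {j}" "\<phi>(j := i)" "I - {i}"] by simp
  then have "bij_betw (\<phi>(j := i)) J I" using i j by (simp add: insert_absorb)
  then show ?case using \<phi>(2) i j by (intro exI[of _ "\<phi>(j := i)"]) auto
qed

end

section \<open>Application to diagonal singular value decompositions\<close>

theorem theorem1p8:
  fixes scale :: "complex \<Rightarrow> 'v::ab_group_add \<Rightarrow> 'v"
    and V :: "'v set"
    and ip :: "'v \<Rightarrow> 'v \<Rightarrow> complex"
    and d :: nat
    and scaleH :: "complex \<Rightarrow> 'a::ab_group_add \<Rightarrow> 'a"
    and H :: "nat \<Rightarrow> 'a set"
    and ipH :: "nat \<Rightarrow> 'a \<Rightarrow> 'a \<Rightarrow> complex"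
    and tens :: "(nat \<Rightarrow> 'a) \<Rightarrow> 'v"
    and T :: 'v
    and r :: nat and \<sigma> :: "nat \<Rightarrow> real" and v :: "nat \<Rightarrow> 'v"
    and t :: real
  assumes "hilbert_tensor_product scale V ip d scaleH H ipH tens"
    and "T \<in> V"
    and "diagonal_svd scale V (pure_tensors d H tens) ip T r \<sigma> v"
    and "t > 2"
    and "t_orthogonal V (pure_tensors d H tens) ip t r v"
  shows "\<forall>s \<mu> w. diagonal_svd scale V (pure_tensors d H tens) ip T s \<mu> w \<longrightarrow>
           s = r \<and> (\<exists>\<phi>. \<phi> permutes {1..r} \<and>
             (\<forall>i\<in>{1..r}. \<mu> i = \<sigma> (\<phi> i) \<and> w i = v (\<phi> i)))"
proof (intro allI impI)
  fix s \<mu> w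
  let ?P = "pure_tensors d H tens"
  assume W: "diagonal_svd scale V ?P ip T s \<mu> w"
  interpret hilbert_tensor_product scale V ip d scaleH H ipH tens by (rule assms(1))
  have PV: "?P \<subseteq> V"
    using V.span_superset[of "tens ` Pi\<^sub>E {1..d} H"] span_tens by (simp add: pure_tensors_def)
  \<comment> \<open>For \<open>t = 2\<close> the exponent \<open>2 / t\<close> is 1.\<close>
  have w2: "(\<Sum>j=1..s. cmod (ip (w j) u)) \<le> 1" if "u \<in> ?P" "ip_norm ip u = 1" for u
    using V.t_orthogonal_sum_le[of ?P 2 s w u] W that PV by (simp add: diagonal_svd_def)
  have "\<exists>\<phi>. bij_betw \<phi> {1..s} {1..r} \<and> (\<forall>j\<in>{1..s}. \<mu> j = \<sigma> (\<phi> j) \<and> w j = v (\<phi> j))"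
  \<comment> \<open>The assumption \<open>t > 2\<close> becomes \<open>\<alpha> < 1\<close>.\<close>
  proof (rule V.combination_unique[where P = ?P and \<alpha> = "2 / t"])
    show "(\<Sum>i=1..r. cmod (ip (v i) u) powr (2 / t)) \<le> 1" if "u \<in> ?P" "ip_norm ip u = 1" for u
      using V.t_orthogonal_sum_le[OF assms(5)] assms(4) PV that by simp
  qed (use w2 PV W assms(3,4) in \<open>auto simp: diagonal_svd_def t_orthogonal_def\<close>)
  then obtain \<phi> where \<phi>: "bij_betw \<phi> {1..s} {1..r}"
      "\<And>j. j \<in> {1..s} \<Longrightarrow> \<mu> j = \<sigma> (\<phi> j) \<and> w j = v (\<phi> j)" by blast
  have sr: "s = r" using bij_betw_same_card[OF \<phi>(1)] by simp
  \<comment> \<open>\<open>permutes\<close> demands the identity outside \<open>{1..r}\<close>,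
    where \<open>\<phi>\<close> is unconstrained.\<close>
  define \<psi> where "\<psi> i = (if i \<in> {1..r} then \<phi> i else i)" for i
  have "bij_betw \<psi> {1..r} {1..r}"
    using \<phi>(1) sr by (subst bij_betw_cong[where g = \<phi>]) (auto simp: \<psi>_def)
  then have "\<psi> permutes {1..r}"
    by (rule bij_imp_permutes) (auto simp: \<psi>_def)
  then show "s = r \<and> (\<exists>\<phi>. \<phi> permutes {1..r} \<and> (\<forall>i\<in>{1..r}. \<mu> i = \<sigma> (\<phi> i) \<and> w i = v (\<phi> i)))"
    using sr \<phi>(2) by (intro conjI exI[of _ \<psi>]) (auto simp: \<psi>_def)
qed

end
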